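(* Let $W_1,\dots,W_N:\mathbb{R}^N\to\mathbb{R}$ be the components of the nonlinear RBF collocation system described in the context, $W_i(\vec\alpha)=\mathcal{W}_i\big(D_1\tilde u(\mathbf{x}_i),\dots,D_S\tilde u(\mathbf{x}_i)\big)$ with $\tilde u(\mathbf{x})=\sum_{j=1}^N\alpha_j\,\phi(\|\mathbf{x}-\mathbf{x}_j\|)$, and let $\mu(\vec\alpha)=\frac12\sum_{i=1}^N W_i(\vec\alpha)^2$. Then for every $\vec\alpha\in\mathbb{R}^N$ the Jacobian $J(\vec\alpha)=\big(\partial W_i/\partial\alpha_j\big)_{i,j=1}^N$ of $\vec W=(W_1,\dots,W_N)^T$ is $$J(\vec\alpha)=\sum_{m=1}^S \mathrm{diag}\Big[\frac{\partial W}{\partial D_m}\Big]\,[D_m\phi],$$ and the Hessian $H(\vec\alpha)=\nabla^2\mu(\vec\alpha)$ is $$H(\vec\alpha)=\sum_{m=1}^S\sum_{n=1}^S [D_m\phi]^T\Big(\mathrm{diag}\Big[\frac{\partial W}{\partial D_m}\frac{\partial W}{\partial D_n}\Big]+\mathrm{diag}\Big[W\frac{\partial^2 W}{\partial D_m\partial D_n}\Big]\Big)[D_n\phi]=\frac12\sum_{m=1}^S\sum_{n=1}^S [D_m\phi]^T\,\mathrm{diag}\Big[\frac{\partial^2 W^2}{\partial D_m\partial D_n}\Big][D_n\phi].$$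
   Context: Setting: $\Omega\subset\mathbb{R}^d$ is a bounded domain, $\mathbf{x}_1,\dots,\mathbf{x}_N$ are distinct points, the first $M$ in $\Omega$ and the last $N-M$ on $\partial\Omega$. $\phi:[0,\infty)\to\mathbb{R}$ is a radial basis function such that each function $\mathbf{x}\mapsto\phi(\|\mathbf{x}-\mathbf{x}_j\|)$ (2-norm) is smooth enough for the operators below to be applied. $D_1,\dots,D_S$ are linear differential operators in $\mathbf{x}$ (possibly including the identity). A nonlinear boundary value problem $\mathcal{W}^{PDE}=0$ in $\Omega$, $\mathcal{W}^{BC}=0$ on $\partial\Omega$, whose operators are smooth functions of $\mathbf{x}$ and of $D_1u(\mathbf{x}),\dots,D_Su(\mathbf{x})$, is collocated at the points. For each $i$, $\mathcal{W}_i:\mathbb{R}^S\to\mathbb{R}$ denotes the resulting smooth function of $S$ real variables at $\mathbf{x}_i$ (coming from $\mathcal{W}^{PDE}$ if $\mathbf{x}_i\in\Omega$ and from $\mathcal{W}^{BC}$ if $\mathbf{x}_i\in\partial\Omega$). Notation: $D_m\phi_{ij}$ is the value at $\mathbf{x}=\mathbf{x}_i$ of $D_m$ applied to the function $\mathbf{x}\mapsto\phi(\|\mathbf{x}-\mathbf{x}_j\|)$, and $[D_m\phi]=(D_m\phi_{ij})_{i,j=1}^N$. $\partial W_i/\partial D_m$ denotes the partial derivative of $\mathcal{W}_i$ with respect to its $m$-th argument, evaluated at $(D_1\tilde u(\mathbf{x}_i),\dots,D_S\tilde u(\mathbf{x}_i))$; similarly $\partial^2 W_i/\partial D_m\partial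 D_n$ is the corresponding second partial derivative, and $\partial^2W_i^2/\partial D_m\partial D_n$ that of the function $\mathcal{W}_i^2$. For a quantity $f$ with nodal values $f_1,\dots,f_N$, $\mathrm{diag}[f]$ is the diagonal matrix with diagonal entries $f_1,\dots,f_N$; e.g. $\mathrm{diag}[W\,\partial^2W/\partial D_m\partial D_n]$ has $i$-th entry $W_i\,\partial^2W_i/\partial D_m\partial D_n$. *)

theory Defs
  imports "HOL-Analysis.Analysis"
begin

section \<open>Partial derivatives and smoothness\<close>

definition partial_deriv :: "'a::real_normed_vector \<Rightarrow> ('a \<Rightarrow> real) \<Rightarrow> 'a \<Rightarrow> real" where
  "partial_deriv b f x = deriv (\<lambda>t. f (x + t *\<^sub>R b)) 0"

text \<open>\<open>C\<^sup>k\<close> on \<open>U\<close>; only meant for open \<open>U\<close>. Demanding differentiability, rather than mere existence of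
  the first partial derivatives, gives the same class, since continuous partial derivatives
  imply differentiability.\<close>

fun Ck_on :: "nat \<Rightarrow> 'a::euclidean_space set \<Rightarrow> ('a \<Rightarrow> real) \<Rightarrow> bool" where
  "Ck_on 0 U f \<longleftrightarrow> continuous_on U f"
| "Ck_on (Suc k) U f \<longleftrightarrow>
     (\<forall>x\<in>U. f differentiable (at x)) \<and> (\<forall>b\<in>Basis. Ck_on k U (partial_deriv b f))"

text \<open>Smoothness on an arbitrary set, such as \<open>\<partial>\<Omega> \<times> \<real>\<^sup>S\<close>, is the existence of a smooth extension
  to an open neighbourhood; on an open set this is ordinary \<open>C\<^sup>\<infinity>\<close> smoothness.\<close>

definition smooth_on :: "'a::euclidean_space set \<Rightarrow> ('a \<Rightarrow> real) \<Rightarrow> bool" where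
  "smooth_on X f \<longleftrightarrow>
     (\<exists>U g. open U \<and> X \<subseteq> U \<and> (\<forall>k. Ck_on k U g) \<and> (\<forall>z\<in>X. f z = g z))"

section \<open>Linear differential operators\<close>

primrec iter_partial :: "'a::real_normed_vector list \<Rightarrow> ('a \<Rightarrow> real) \<Rightarrow> 'a \<Rightarrow> real" where
  "iter_partial [] u = u"
| "iter_partial (b # bs) u = partial_deriv b (iter_partial bs u)"

text \<open>\<open>L\<close> has order at most \<open>k\<close>, with coefficient functions \<open>c bs\<close>. A list of at most \<open>k\<close> basis
  vectors plays the role of a multi-index. The values of \<open>L\<close> are
  prescribed only at points near which the argument is \<open>C\<^sup>k\<close>.\<close>

definition linear_diff_op ::
  "nat \<Rightarrow> (('a::euclidean_space \<Rightarrow> real) \<Rightarrow> 'a \<Rightarrow> real) \<Rightarrow> bool" where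
  "linear_diff_op k L \<longleftrightarrow>
     (\<exists>c. \<forall>U u x. open U \<longrightarrow> x \<in> U \<longrightarrow> Ck_on k U u \<longrightarrow>
        L u x = (\<Sum>bs | set bs \<subseteq> Basis \<and> length bs \<le> k. c bs x * iter_partial bs u x))"

section \<open>RBF collocation\<close>

definition rbf :: "(real \<Rightarrow> real) \<Rightarrow> 'a::real_normed_vector \<Rightarrow> 'a \<Rightarrow> real" where
  "rbf \<phi> c = (\<lambda>y. \<phi> (norm (y - c)))"

definition rbf_interpolant ::
  "(real \<Rightarrow> real) \<Rightarrow> ('n::finite \<Rightarrow> 'a::real_normed_vector) \<Rightarrow> real^'n \<Rightarrow> 'a \<Rightarrow> real" where
  "rbf_interpolant \<phi> x \<alpha> = (\<lambda>y. \<Sum>j\<in>UNIV. \<alpha> $ j * rbf \<phi> (x j) y)"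

definition op_values ::
  "('s::finite \<Rightarrow> ('a \<Rightarrow> real) \<Rightarrow> 'a \<Rightarrow> real) \<Rightarrow> ('a \<Rightarrow> real) \<Rightarrow> 'a \<Rightarrow> real^'s" where
  "op_values D u y = (\<chi> m. D m u y)"

definition op_matrix ::
  "(('a::real_normed_vector \<Rightarrow> real) \<Rightarrow> 'a \<Rightarrow> real) \<Rightarrow> (real \<Rightarrow> real) \<Rightarrow> ('n::finite \<Rightarrow> 'a) \<Rightarrow> real^'n^'n"
  where "op_matrix L \<phi> x = (\<chi> i j. L (rbf \<phi> (x j)) (x i))"

definition nodal_fun ::
  "'a set \<Rightarrow> ('a \<Rightarrow> real^'s \<Rightarrow> real) \<Rightarrow> ('a \<Rightarrow> real^'s \<Rightarrow> real) \<Rightarrow> ('n \<Rightarrow> 'a) \<Rightarrow> 'n \<Rightarrow> real^'s \<Rightarrow> real"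
  where "nodal_fun \<Omega> Wpde Wbc x i = (if x i \<in> \<Omega> then Wpde (x i) else Wbc (x i))"

definition diag :: "('n::finite \<Rightarrow> real) \<Rightarrow> real^'n^'n" where
  "diag f = (\<chi> i j. if i = j then f i else 0)"

definition jacobian_matrix :: "(real^'n \<Rightarrow> real^'m) \<Rightarrow> real^'n \<Rightarrow> real^'n^'m" where
  "jacobian_matrix F a = (\<chi> i j. partial_deriv (axis j 1) (\<lambda>a. F a $ i) a)"

definition hessian_matrix :: "(real^'n \<Rightarrow> real) \<Rightarrow> real^'n \<Rightarrow> real^'n^'n" where
  "hessian_matrix f a = (\<chi> i j. partial_deriv (axis i 1) (partial_deriv (axis j 1) f) a)"

end

(* Near the nodes each D_m acts linearly on C^k functions, so the operator values at x_i depend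
   linearly on alpha, through the i-th rows of the matrices [D_m phi]. Everything else is the
   chain rule applied to w_i and to its first partial derivatives. Symmetry of second derivatives
   is never needed, since both sides differentiate in the same order. *)

theory Submission
  imports Defs
begin

section \<open>Partial derivatives\<close>

text \<open>Chain rule along the line \<open>x + t *\<^sub>R b\<close>. This allows partial
  derivatives to be read off from total derivatives.\<close>

lemma partial_deriv_eq:
  assumes "(f has_derivative f') (at x)"
  shows "partial_deriv b f x = f' b"
proof -
  interpret bounded_linear f' using assms by (rule has_derivative_bounded_linear)
  have "((\<lambda>t. x + t *\<^sub>R b) has_derivative (\<lambda>t. t *\<^sub>R b)) (at 0)"
    by (auto intro!: derivative_eq_intros)
  moreover have "(f has_derivative f') (at (x + 0 *\<^sub>R b))" using assms by simp
  ultimately have "((\<lambda>t. f (x + t *\<^sub>R b)) has_derivative (\<lambda>t. f' (t *\<^sub>R b))) (at 0)"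
    by (rule has_derivative_compose)
  moreover have "(\<lambda>t. f' (t *\<^sub>R b)) = (*) (f' b)" by (simp add: fun_eq_iff scaleR)
  ultimately have "((\<lambda>t. f (x + t *\<^sub>R b)) has_field_derivative f' b) (at 0)"
    by (simp add: has_field_derivative_def)
  then show ?thesis unfolding partial_deriv_def by (rule DERIV_imp_deriv)
qed

text \<open>A linear map is determined by its values on the vectors \<open>axis m 1\<close>, and
  those values of the total derivative are the partial derivatives.\<close>

lemma has_derivative_partial_deriv:
  fixes f :: "real^'n \<Rightarrow> real"
  assumes "f differentiable (at x)"
  shows "(f has_derivative (\<lambda>h. \<Sum>m\<in>UNIV. h $ m * partial_deriv (axis m 1) f x)) (at x)"
proof -
  obtain f' where f': "(f has_derivative f') (at x)"
    using assms unfolding differentiable_def by blast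
  interpret bounded_linear f' using f' by (rule has_derivative_bounded_linear)
  have "f' h = (\<Sum>m\<in>UNIV. h $ m * partial_deriv (axis m 1) f x)" for h
  proof -
    have "f' h = f' (\<Sum>m\<in>UNIV. h $ m *\<^sub>R axis m 1)"
      by (simp add: basis_expansion flip: scalar_mult_eq_scaleR)
    then show ?thesis by (simp add: sum scaleR partial_deriv_eq[OF f'])
  qed
  then have "f' = (\<lambda>h. \<Sum>m\<in>UNIV. h $ m * partial_deriv (axis m 1) f x)"
    by (rule ext)
  then show ?thesis using f' by simp
qed

text \<open>For small \<open>t\<close> the line \<open>x + t *\<^sub>R b\<close> stays in
  \<open>U\<close>, so only values near \<open>x\<close> matter. This allows differentiating
  identities that hold only on an open set.\<close>

lemma partial_deriv_cong_open:
  assumes "open U" "x \<in> U" "\<And>y. y \<in> U \<Longrightarrow> f y = g y"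
  shows "partial_deriv b f x = partial_deriv b g x"
proof -
  have "((\<lambda>t. x + t *\<^sub>R b) \<longlongrightarrow> x + 0 *\<^sub>R b) (nhds 0)"
    by (intro tendsto_intros filterlim_ident)
  then have "\<forall>\<^sub>F t in nhds 0. x + t *\<^sub>R b \<in> U"
    using assms(1,2) topological_tendstoD by fastforce
  then have "\<forall>\<^sub>F t in nhds 0. f (x + t *\<^sub>R b) = g (x + t *\<^sub>R b)"
    by eventually_elim (rule assms(3))
  then show ?thesis unfolding partial_deriv_def by (intro deriv_cong_ev) auto
qed

lemma partial_deriv_sum:
  assumes "\<And>j. j \<in> J \<Longrightarrow> f j differentiable (at x)"
  shows "partial_deriv b (\<lambda>y. \<Sum>j\<in>J. a j * f j y) x = (\<Sum>j\<in>J. a j * partial_deriv b (f j) x)"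
proof -
  obtain f' where f': "\<And>j. j \<in> J \<Longrightarrow> (f j has_derivative f' j) (at x)"
    using assms unfolding differentiable_def by metis
  have "((\<lambda>y. \<Sum>j\<in>J. a j * f j y) has_derivative (\<lambda>h. \<Sum>j\<in>J. a j * f' j h)) (at x)"
    by (intro has_derivative_sum has_derivative_mult_right f')
  then have "partial_deriv b (\<lambda>y. \<Sum>j\<in>J. a j * f j y) x = (\<Sum>j\<in>J. a j * f' j b)"
    by (rule partial_deriv_eq)
  then show ?thesis by (simp add: partial_deriv_eq[OF f'] cong: sum.cong)
qed

text \<open>Product rule applied twice. Differentiability of \<open>f\<close> at every point gives
  the first partial derivative of the square as a function, which can then be differentiated at
  \<open>q\<close>.\<close>

lemma partial_deriv_partial_deriv_square:
  assumes f: "\<And>q. f differentiable (at q)"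
    and df: "partial_deriv b f differentiable (at q)"
  shows "partial_deriv a (partial_deriv b (\<lambda>q. (f q)\<^sup>2)) q =
    2 * (partial_deriv a f q * partial_deriv b f q + f q * partial_deriv a (partial_deriv b f) q)"
proof -
  obtain f' where f': "\<And>q. (f has_derivative f' q) (at q)"
    using f unfolding differentiable_def by metis
  obtain g' where g': "(partial_deriv b f has_derivative g') (at q)"
    using df unfolding differentiable_def by blast
  have "((\<lambda>q. (f q)\<^sup>2) has_derivative (\<lambda>h. 2 * f q * f' q h)) (at q)" for q
    by (auto intro!: derivative_eq_intros f')
  from partial_deriv_eq[OF this] have eq: "partial_deriv b (\<lambda>q. (f q)\<^sup>2) = (\<lambda>q. 2 * (f q * partial_deriv b f q))"
    by (simp add: fun_eq_iff partial_deriv_eq[OF f'])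
  have "((\<lambda>q. 2 * (f q * partial_deriv b f q)) has_derivative
      (\<lambda>h. 2 * (f q * g' h + f' q h * partial_deriv b f q))) (at q)"
    by (intro has_derivative_mult_right has_derivative_mult f' g')
  then show ?thesis
    unfolding eq by (simp add: partial_deriv_eq partial_deriv_eq[OF f'] partial_deriv_eq[OF g'])
qed

section \<open>Linear differential operators act linearly\<close>

text \<open>On an open set, agreement of two functions passes to their partial derivatives, so the
  induction has to generalise over both functions.\<close>

lemma Ck_on_cong:
  assumes "open U" "\<And>y. y \<in> U \<Longrightarrow> f y = g y" "Ck_on k U f"
  shows "Ck_on k U g"
  using assms(2,3)
proof (induction k arbitrary: f g)
  case 0
  then show ?case by (simp cong: continuous_on_cong)
next
  case (Suc k)
  have "g differentiable (at y)" if "y \<in> U" for y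
  proof -
    obtain f' where "(f has_derivative f') (at y)"
      using Suc.prems(2) \<open>y \<in> U\<close> unfolding Ck_on.simps differentiable_def by blast
    from has_derivative_transform_within_open[OF this \<open>open U\<close> \<open>y \<in> U\<close> Suc.prems(1)]
    show ?thesis unfolding differentiable_def by blast
  qed
  moreover have "Ck_on k U (partial_deriv b g)" if "b \<in> Basis" for b
  proof (rule Suc.IH)
    show "partial_deriv b f y = partial_deriv b g y" if "y \<in> U" for y
      by (rule partial_deriv_cong_open[OF \<open>open U\<close> that Suc.prems(1)])
    show "Ck_on k U (partial_deriv b f)" using Suc.prems(2) that by simp
  qed
  ultimately show ?case by simp
qed

text \<open>The partial derivative of the combination equals the combination of partial derivatives
  on \<open>U\<close> only; \<open>Ck_on_cong\<close> bridges this gap in the induction.\<close>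

lemma Ck_on_sum:
  assumes "open U" "\<And>j. j \<in> J \<Longrightarrow> Ck_on k U (f j)"
  shows "Ck_on k U (\<lambda>y. \<Sum>j\<in>J. a j * f j y)"
  using assms(2)
proof (induction k arbitrary: f)
  case 0
  then show ?case by (simp add: continuous_on_sum continuous_on_mult_left)
next
  case (Suc k)
  have diff: "f j differentiable (at y)" if "j \<in> J" "y \<in> U" for j y
    using Suc.prems that by simp
  have "(\<lambda>y. \<Sum>j\<in>J. a j * f j y) differentiable (at y)" if "y \<in> U" for y
  proof (cases "finite J")
    case True
    then show ?thesis
      using diff that by (intro differentiable_sum differentiable_mult differentiable_const) auto
  \<comment> \<open>Over an infinite \<open>J\<close> the sum is 0 by convention, hence a constant
    function.\<close>
  qed simp
  moreover have "Ck_on k U (partial_deriv b (\<lambda>y. \<Sum>j\<in>J. a j * f j y))" if "b \<in> Basis" for b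
  proof (rule Ck_on_cong[OF \<open>open U\<close>])
    show "Ck_on k U (\<lambda>y. \<Sum>j\<in>J. a j * partial_deriv b (f j) y)"
      using Suc.prems that by (intro Suc.IH) auto
    show "(\<Sum>j\<in>J. a j * partial_deriv b (f j) y) = partial_deriv b (\<lambda>y. \<Sum>j\<in>J. a j * f j y) y"
      if "y \<in> U" for y
      using diff that by (simp add: partial_deriv_sum)
  qed
  ultimately show ?case by simp
qed

lemma Ck_on_Suc_imp: "Ck_on (Suc k) U f \<Longrightarrow> Ck_on k U f"
proof (induction k arbitrary: f)
  case 0
  then show ?case
    by (auto intro!: continuous_at_imp_continuous_on differentiable_imp_continuous_within)
next
  case (Suc k)
  have "Ck_on k U (partial_deriv b f)" if "b \<in> Basis" for b
    using Suc.prems that by (intro Suc.IH) (auto simp only: Ck_on.simps)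
  then show ?case using Suc.prems by (auto simp only: Ck_on.simps)
qed

lemma Ck_on_mono: "l \<le> k \<Longrightarrow> Ck_on k U f \<Longrightarrow> Ck_on l U f"
  by (induction k rule: dec_induct) (auto dest: Ck_on_Suc_imp simp del: Ck_on.simps)

text \<open>Each derivative costs one order. The head of the list is applied last, so the induction
  hypothesis is used for the tail at order \<open>Suc k\<close>.\<close>

lemma Ck_on_iter_partial:
  assumes "set bs \<subseteq> Basis" "Ck_on (k + length bs) U u"
  shows "Ck_on k U (iter_partial bs u)"
  using assms
proof (induction bs arbitrary: k)
  case (Cons b bs)
  then have "Ck_on (Suc k) U (iter_partial bs u)" by (simp del: Ck_on.simps)
  then show ?case using Cons.prems(1) by simp
qed simp

text \<open>The outermost derivative sees a neighbourhood of \<open>y\<close>, so the induction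
  carries the identity at all points of \<open>U\<close>.\<close>

lemma iter_partial_sum:
  assumes "open U" "set bs \<subseteq> Basis" "\<And>j. j \<in> J \<Longrightarrow> Ck_on (length bs) U (f j)" "y \<in> U"
  shows "iter_partial bs (\<lambda>y. \<Sum>j\<in>J. a j * f j y) y = (\<Sum>j\<in>J. a j * iter_partial bs (f j) y)"
  using assms(2-)
proof (induction bs arbitrary: y)
  case (Cons b bs)
  have "iter_partial bs (\<lambda>y. \<Sum>j\<in>J. a j * f j y) z = (\<Sum>j\<in>J. a j * iter_partial bs (f j) z)"
    if "z \<in> U" for z
    using Cons.prems that
    by (intro Cons.IH) (auto intro: Ck_on_Suc_imp simp del: Ck_on.simps)
  then have "partial_deriv b (iter_partial bs (\<lambda>y. \<Sum>j\<in>J. a j * f j y)) y =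
      partial_deriv b (\<lambda>z. \<Sum>j\<in>J. a j * iter_partial bs (f j) z) y"
    by (rule partial_deriv_cong_open[OF \<open>open U\<close> \<open>y \<in> U\<close>])
  moreover have "iter_partial bs (f j) differentiable (at y)" if "j \<in> J" for j
  proof -
    \<comment> \<open>The tail consumes \<open>length bs\<close> of the
      \<open>length (b # bs)\<close> available orders; the one left over yields
      differentiability.\<close>
    have "Ck_on (Suc 0) U (iter_partial bs (f j))"
      using Cons.prems that by (intro Ck_on_iter_partial) (auto simp del: Ck_on.simps)
    then show ?thesis using \<open>y \<in> U\<close> by simp
  qed
  ultimately show ?case by (simp add: partial_deriv_sum)
qed simp

lemma linear_diff_op_sum:
  assumes L: "linear_diff_op k L" and "open U" "y \<in> U"
    and f: "\<And>j. j \<in> J \<Longrightarrow> Ck_on k U (f j)"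
  shows "L (\<lambda>y. \<Sum>j\<in>J. a j * f j y) y = (\<Sum>j\<in>J. a j * L (f j) y)"
proof -
  let ?B = "{bs::'a list. set bs \<subseteq> Basis \<and> length bs \<le> k}"
  \<comment> \<open>The coefficients do not depend on \<open>u\<close>, so the same \<open>c\<close>
    serves each \<open>f j\<close> and, by \<open>Ck_on_sum\<close>, their combination.\<close>
  obtain c where c: "\<And>u. Ck_on k U u \<Longrightarrow> L u y = (\<Sum>bs\<in>?B. c bs y * iter_partial bs u y)"
    using L assms(2,3) unfolding linear_diff_op_def by blast
  have "L (\<lambda>y. \<Sum>j\<in>J. a j * f j y) y =
      (\<Sum>bs\<in>?B. c bs y * iter_partial bs (\<lambda>y. \<Sum>j\<in>J. a j * f j y) y)"
    by (intro c Ck_on_sum \<open>open U\<close> f)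
  also have "\<dots> = (\<Sum>bs\<in>?B. \<Sum>j\<in>J. a j * (c bs y * iter_partial bs (f j) y))"
  proof (rule sum.cong[OF refl])
    fix bs assume "bs \<in> ?B"
    then have "iter_partial bs (\<lambda>y. \<Sum>j\<in>J. a j * f j y) y = (\<Sum>j\<in>J. a j * iter_partial bs (f j) y)"
      using f by (intro iter_partial_sum[OF \<open>open U\<close> _ _ \<open>y \<in> U\<close>]) (auto intro: Ck_on_mono)
    then show "c bs y * iter_partial bs (\<lambda>y. \<Sum>j\<in>J. a j * f j y) y =
        (\<Sum>j\<in>J. a j * (c bs y * iter_partial bs (f j) y))"
      by (simp add: sum_distrib_left mult_ac)
  qed
  also have "\<dots> = (\<Sum>j\<in>J. a j * L (f j) y)"
    by (subst sum.swap) (simp add: c f sum_distrib_left)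
  finally show ?thesis .
qed

section \<open>The nodal functions and their composition with a linear map\<close>

text \<open>Fixing \<open>y\<close> in \<open>X\<close>, which may be a boundary, leaves all of
  \<open>{y} \<times> UNIV\<close> inside the open domain of the smooth extension \<open>g\<close>.
  Hence \<open>F y\<close> is a full slice of \<open>g\<close>, and its partial derivative along
  \<open>b\<close> is that of \<open>g\<close> along \<open>(0, b)\<close>.\<close>

lemma smooth_on_slice:
  fixes F :: "'a::euclidean_space \<Rightarrow> 'b::euclidean_space \<Rightarrow> real"
  assumes "smooth_on (X \<times> UNIV) (\<lambda>(y, q). F y q)" "y \<in> X"
  shows "F y differentiable (at q)"
    and "b \<in> Basis \<Longrightarrow> partial_deriv b (F y) differentiable (at q)"
proof -
  obtain V g where V: "X \<times> UNIV \<subseteq> V" "\<And>k. Ck_on k V g"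
    and g: "\<And>z. z \<in> X \<times> UNIV \<Longrightarrow> (case z of (y, q) \<Rightarrow> F y q) = g z"
    using assms(1) unfolding smooth_on_def by blast
  have F: "F y = (\<lambda>q. g (y, q))" using g \<open>y \<in> X\<close> by fastforce
  have mem: "(y, q) \<in> V" for q using V(1) \<open>y \<in> X\<close> by auto
  have slice: "(\<lambda>q. h (y, q)) differentiable (at q)" if "h differentiable (at (y, q))"
    for h :: "'a \<times> 'b \<Rightarrow> real"
    using that unfolding differentiable_def
    by (auto intro: has_derivative_compose[OF has_derivative_Pair[OF has_derivative_const has_derivative_ident]])
  show "F y differentiable (at q)"
    unfolding F using V(2)[of "Suc 0"] mem by (intro slice) simp
  show "partial_deriv b (F y) differentiable (at q)" if "b \<in> Basis"
  proof -
    have "(0, b) \<in> Basis" using that by (simp add: Basis_prod_def)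
    \<comment> \<open>Order two of \<open>g\<close> is what makes its first partial derivatives
      differentiable.\<close>
    then have "partial_deriv (0, b) g differentiable (at (y, q))"
      using V(2)[of "Suc (Suc 0)"] mem by fastforce
    moreover have "partial_deriv b (F y) = (\<lambda>q. partial_deriv (0, b) g (y, q))"
      by (simp add: F partial_deriv_def fun_eq_iff)
    ultimately show ?thesis using slice by simp
  qed
qed

text \<open>Chain rule for \<open>f\<close> after the linear map that collects the
  \<open>i\<close>-th entries of all \<open>A m *v \<alpha>\<close>. Keeping \<open>f\<close>
  general covers both a nodal function and its first partial derivatives.\<close>

lemma has_derivative_compose_matrices:
  fixes f :: "real^'s \<Rightarrow> real" and A :: "'s \<Rightarrow> real^'n^'m"
  assumes "\<And>q. f differentiable (at q)"
  shows "((\<lambda>\<alpha>. f (\<chi> m. (A m *v \<alpha>) $ i)) has_derivative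
    (\<lambda>h. \<Sum>m\<in>UNIV. (A m *v h) $ i * partial_deriv (axis m 1) f (\<chi> m. (A m *v \<alpha>) $ i))) (at \<alpha>)"
proof -
  have "linear (\<lambda>\<alpha>. \<chi> m. (A m *v \<alpha>) $ i)"
    by (rule linearI)
      (simp_all add: vec_eq_iff matrix_vector_right_distrib matrix_vector_mult_scaleR)
  then have "((\<lambda>\<alpha>. \<chi> m. (A m *v \<alpha>) $ i) has_derivative (\<lambda>\<alpha>. \<chi> m. (A m *v \<alpha>) $ i)) (at \<alpha>)"
    by (simp add: linear_imp_has_derivative)
  from has_derivative_compose[OF this has_derivative_partial_deriv[OF assms]]
  show ?thesis by simp
qed

section \<open>Entries of products with diagonal matrices\<close>

lemma transpose_diag_mult_nth:
  "(transpose A ** diag f ** B) $ i $ j = (\<Sum>k\<in>UNIV. A $ k $ i * f k * B $ k $ j)"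
  by (simp add: matrix_matrix_mult_def transpose_def diag_def mult_delta_left mult_delta_right)

lemma diag_mult_nth: "(diag f ** A) $ i $ j = f i * A $ i $ j"
  by (simp add: matrix_matrix_mult_def diag_def mult_delta_left)

lemma diag_add: "diag f + diag g = diag (\<lambda>i. f i + g i)"
  by (simp add: diag_def vec_eq_iff)

text \<open>Since \<open>deriv\<close> has an unspecified value where no derivative exists, the
  differentiability claims in the conclusion ensure that the matrix entries are genuine derivatives.
  The cardinality of \<open>{..<i}\<close> is the position of node \<open>i\<close> counted from 0,
  so the condition \<open>card {..<i} < M\<close> selects the first \<open>M\<close> nodes.\<close>

theorem mainTheorem1:
  fixes \<Omega> U :: "(real^'d) set"
    and x :: "'n::{finite,linorder} \<Rightarrow> real^'d"
    and M :: nat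
    and \<phi> :: "real \<Rightarrow> real"
    and D :: "'s::finite \<Rightarrow> (real^'d \<Rightarrow> real) \<Rightarrow> real^'d \<Rightarrow> real"
    and ord :: "'s \<Rightarrow> nat"
    and Wpde Wbc :: "real^'d \<Rightarrow> real^'s \<Rightarrow> real"
    and w :: "'n \<Rightarrow> real^'s \<Rightarrow> real"
    and p :: "(real, 'n) vec \<Rightarrow> 'n \<Rightarrow> real^'s"
    and W :: "(real, 'n) vec \<Rightarrow> (real, 'n) vec"
    and \<mu> :: "(real, 'n) vec \<Rightarrow> real"
    and dW :: "'s \<Rightarrow> (real, 'n) vec \<Rightarrow> 'n \<Rightarrow> real"
    and ddW ddW2 :: "'s \<Rightarrow> 's \<Rightarrow> (real, 'n) vec \<Rightarrow> 'n \<Rightarrow> real"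
    and D\<phi> :: "'s \<Rightarrow> ((real, 'n) vec, 'n) vec"
  assumes domain: "open \<Omega>" "connected \<Omega>" "\<Omega> \<noteq> {}" "bounded \<Omega>"
    and distinct_nodes: "inj x"
    and number_interior: "M \<le> CARD('n)"
    and interior_nodes: "\<And>i. card {..<i} < M \<Longrightarrow> x i \<in> \<Omega>"
    and boundary_nodes: "\<And>i. M \<le> card {..<i} \<Longrightarrow> x i \<in> frontier \<Omega>"
    and operators: "\<And>m. linear_diff_op (ord m) (D m)"
    and neighbourhood: "open U" "closure \<Omega> \<subseteq> U"
    and rbf_smooth_enough: "\<And>m j. Ck_on (ord m) U (rbf \<phi> (x j))"
    and Wpde_smooth: "smooth_on (\<Omega> \<times> UNIV) (\<lambda>(y, q). Wpde y q)"
    and Wbc_smooth: "smooth_on (frontier \<Omega> \<times> UNIV) (\<lambda>(y, q). Wbc y q)"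
    and w_eq: "w = nodal_fun \<Omega> Wpde Wbc x"
    and p_eq: "p = (\<lambda>\<alpha> i. op_values D (rbf_interpolant \<phi> x \<alpha>) (x i))"
    and W_eq: "W = (\<lambda>\<alpha>. \<chi> i. w i (p \<alpha> i))"
    and \<mu>_eq: "\<mu> = (\<lambda>\<alpha>. (1/2) * (\<Sum>i\<in>UNIV. (W \<alpha> $ i)\<^sup>2))"
    and dW_eq: "dW = (\<lambda>m \<alpha> i. partial_deriv (axis m 1) (w i) (p \<alpha> i))"
    and ddW_eq: "ddW = (\<lambda>m n \<alpha> i.
           partial_deriv (axis m 1) (partial_deriv (axis n 1) (w i)) (p \<alpha> i))"
    and ddW2_eq: "ddW2 = (\<lambda>m n \<alpha> i.
           partial_deriv (axis m 1) (partial_deriv (axis n 1) (\<lambda>q. (w i q)\<^sup>2)) (p \<alpha> i))"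
    and D\<phi>_eq: "D\<phi> = (\<lambda>m. op_matrix (D m) \<phi> x)"
  shows "\<forall>\<alpha>.
     W differentiable (at \<alpha>) \<and>
     jacobian_matrix W \<alpha> = (\<Sum>m\<in>UNIV. diag (dW m \<alpha>) ** D\<phi> m) \<and>
     \<mu> differentiable (at \<alpha>) \<and>
     (\<forall>j. partial_deriv (axis j 1) \<mu> differentiable (at \<alpha>)) \<and>
     hessian_matrix \<mu> \<alpha> =
       (\<Sum>m\<in>UNIV. \<Sum>n\<in>UNIV. transpose (D\<phi> m) **
          (diag (\<lambda>i. dW m \<alpha> i * dW n \<alpha> i) + diag (\<lambda>i. W \<alpha> $ i * ddW m n \<alpha> i)) ** D\<phi> n) \<and>
     hessian_matrix \<mu> \<alpha> =
       (1/2) *\<^sub>R (\<Sum>m\<in>UNIV. \<Sum>n\<in>UNIV. transpose (D\<phi> m) ** diag (ddW2 m n \<alpha>) ** D\<phi> n)"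
proof
  fix \<alpha> :: "(real, 'n) vec"
  have node: "x i \<in> \<Omega> \<or> x i \<in> frontier \<Omega>" for i
    using interior_nodes boundary_nodes by (meson not_le)
  then have node_U: "x i \<in> U" for i
    using neighbourhood(2) closure_subset frontier_def by fastforce
  \<comment> \<open>In the else branch of \<open>nodal_fun\<close>, \<open>node\<close> places
    \<open>x i\<close> on the frontier, where \<open>Wbc\<close> is smooth.\<close>
  have w_diff: "w i differentiable (at q)" for i q
    unfolding w_eq nodal_fun_def
    using node[of i] smooth_on_slice(1)[OF Wpde_smooth] smooth_on_slice(1)[OF Wbc_smooth] by auto
  have dw_diff: "partial_deriv (axis m 1) (w i) differentiable (at q)" for m i q
    unfolding w_eq nodal_fun_def
    using node[of i] smooth_on_slice(2)[OF Wpde_smooth] smooth_on_slice(2)[OF Wbc_smooth]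
    by (auto simp: axis_in_Basis_iff)
  \<comment> \<open>The operators enter only here; afterwards they are represented by the matrices
    \<open>D\<phi> m\<close>.\<close>
  have p: "p \<alpha> i = (\<chi> m. (D\<phi> m *v \<alpha>) $ i)" for \<alpha> i
  proof -
    have "D m (rbf_interpolant \<phi> x \<alpha>) (x i) = (\<Sum>j\<in>UNIV. \<alpha> $ j * D m (rbf \<phi> (x j)) (x i))" for m
      unfolding rbf_interpolant_def
      by (intro linear_diff_op_sum[OF operators neighbourhood(1) node_U] rbf_smooth_enough)
    then show ?thesis
      by (simp add: p_eq op_values_def D\<phi>_eq op_matrix_def matrix_vector_mult_def vec_eq_iff mult_ac)
  qed
  \<comment> \<open>Evaluating a derivative in direction \<open>axis j 1\<close> thus produces the
    matrix entries of the claimed formulas.\<close>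
  have axis: "(D\<phi> m *v axis j 1) $ i = D\<phi> m $ i $ j" for m i j
    by (simp add: matrix_vector_mult_basis column_def)
  have dW_i: "((\<lambda>\<alpha>. W \<alpha> $ i) has_derivative
      (\<lambda>h. \<Sum>m\<in>UNIV. (D\<phi> m *v h) $ i * dW m \<alpha> i)) (at \<alpha>)" for \<alpha> i
    using has_derivative_compose_matrices[OF w_diff, of i D\<phi> i \<alpha>] by (simp add: W_eq dW_eq p)
  have ddW_i: "((\<lambda>\<alpha>. dW n \<alpha> i) has_derivative
      (\<lambda>h. \<Sum>m\<in>UNIV. (D\<phi> m *v h) $ i * ddW m n \<alpha> i)) (at \<alpha>)" for \<alpha> i n
    using has_derivative_compose_matrices[OF dw_diff, of n i D\<phi> i \<alpha>]
    by (simp add: dW_eq ddW_eq p)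
  have W_diff: "W differentiable (at \<alpha>)"
  proof -
    have "(W has_derivative (\<lambda>h. \<chi> i. \<Sum>m\<in>UNIV. (D\<phi> m *v h) $ i * dW m \<alpha> i)) (at \<alpha>)"
      by (subst has_derivative_componentwise_within)
        (auto simp: Basis_vec_def inner_axis dW_i)
    then show ?thesis unfolding differentiable_def by blast
  qed
  have jac: "jacobian_matrix W \<alpha> = (\<Sum>m\<in>UNIV. diag (dW m \<alpha>) ** D\<phi> m)"
    by (simp add: vec_eq_iff jacobian_matrix_def partial_deriv_eq[OF dW_i] axis diag_mult_nth mult_ac)
  \<comment> \<open>Here \<alpha> is arbitrary and shadows the fixed one: the gradient must be known
    as a function before it is differentiated again.\<close>
  have \<mu>': "(\<mu> has_derivative
      (\<lambda>h. \<Sum>i\<in>UNIV. W \<alpha> $ i * (\<Sum>m\<in>UNIV. (D\<phi> m *v h) $ i * dW m \<alpha> i))) (at \<alpha>)" for \<alpha>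
  proof -
    have "((\<lambda>\<alpha>. (W \<alpha> $ i)\<^sup>2) has_derivative
        (\<lambda>h. 2 * (W \<alpha> $ i * (\<Sum>m\<in>UNIV. (D\<phi> m *v h) $ i * dW m \<alpha> i)))) (at \<alpha>)" for i
      by (auto intro!: derivative_eq_intros dW_i simp: mult_ac)
    \<comment> \<open>The factor 1/2 in \<open>\<mu>\<close> cancels the 2 from each square.\<close>
    from has_derivative_mult_right[OF has_derivative_sum[where I = UNIV, OF this], where x = "1/2"]
    show ?thesis by (simp add: \<mu>_eq flip: sum_distrib_left)
  qed
  have d\<mu>: "partial_deriv (axis j 1) \<mu> =
      (\<lambda>\<alpha>. \<Sum>i\<in>UNIV. \<Sum>n\<in>UNIV. D\<phi> n $ i $ j * (W \<alpha> $ i * dW n \<alpha> i))" for j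
    by (simp add: fun_eq_iff partial_deriv_eq[OF \<mu>'] axis sum_distrib_left mult_ac)
  \<comment> \<open>By the product rule for \<open>W \<alpha> $ i * dW n \<alpha> i\<close>, the
    first summand gives the second-derivative term of the Hessian and the second gives the product
    of first derivatives.\<close>
  have d\<mu>': "(partial_deriv (axis j 1) \<mu> has_derivative
      (\<lambda>h. \<Sum>i\<in>UNIV. \<Sum>n\<in>UNIV. D\<phi> n $ i $ j *
        (W \<alpha> $ i * (\<Sum>m\<in>UNIV. (D\<phi> m *v h) $ i * ddW m n \<alpha> i)
          + (\<Sum>m\<in>UNIV. (D\<phi> m *v h) $ i * dW m \<alpha> i) * dW n \<alpha> i))) (at \<alpha>)" for j
    unfolding d\<mu> by (intro has_derivative_sum has_derivative_mult_right has_derivative_mult dW_i ddW_i)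
  have hess: "hessian_matrix \<mu> \<alpha> = (\<Sum>m\<in>UNIV. \<Sum>n\<in>UNIV. transpose (D\<phi> m) **
      diag (\<lambda>i. dW m \<alpha> i * dW n \<alpha> i + W \<alpha> $ i * ddW m n \<alpha> i) ** D\<phi> n)"
  proof -
    let ?t = "\<lambda>i j k m n. D\<phi> m $ k $ i * (dW m \<alpha> k * dW n \<alpha> k + W \<alpha> $ k * ddW m n \<alpha> k) * D\<phi> n $ k $ j"
    have "hessian_matrix \<mu> \<alpha> $ i $ j = (\<Sum>m\<in>UNIV. \<Sum>n\<in>UNIV. \<Sum>k\<in>UNIV. ?t i j k m n)" for i j
    proof -
      \<comment> \<open>The inner derivative, along \<open>j\<close>, contributes the index
        \<open>n\<close>; the outer one, along \<open>i\<close>, contributes \<open>m\<close>. This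
        is why \<open>D\<phi> m\<close> ends up transposed. The interchanges that follow move the
        node sum over \<open>k\<close> innermost, where it becomes the matrix product.\<close>
      have "hessian_matrix \<mu> \<alpha> $ i $ j = (\<Sum>k\<in>UNIV. \<Sum>n\<in>UNIV. \<Sum>m\<in>UNIV. ?t i j k m n)"
        by (simp add: hessian_matrix_def partial_deriv_eq[OF d\<mu>'] axis sum_distrib_left
            sum_distrib_right sum.distrib ring_distribs mult_ac)
      also have "\<dots> = (\<Sum>k\<in>UNIV. \<Sum>m\<in>UNIV. \<Sum>n\<in>UNIV. ?t i j k m n)"
        by (intro sum.cong refl sum.swap)
      also have "\<dots> = (\<Sum>m\<in>UNIV. \<Sum>k\<in>UNIV. \<Sum>n\<in>UNIV. ?t i j k m n)"
        by (rule sum.swap)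
      also have "\<dots> = (\<Sum>m\<in>UNIV. \<Sum>n\<in>UNIV. \<Sum>k\<in>UNIV. ?t i j k m n)"
        by (intro sum.cong refl sum.swap)
      finally show ?thesis .
    qed
    then show ?thesis by (simp add: vec_eq_iff transpose_diag_mult_nth)
  qed
  have ddW2: "ddW2 m n \<alpha> = (\<lambda>i. 2 * (dW m \<alpha> i * dW n \<alpha> i + W \<alpha> $ i * ddW m n \<alpha> i))" for m n
    by (simp add: ddW2_eq dW_eq ddW_eq W_eq
        partial_deriv_partial_deriv_square[OF w_diff dw_diff])
  \<comment> \<open>The 2 in \<open>ddW2\<close> cancels the 1/2 term by term, provided it is not
    distributed over the bracket.\<close>
  have hess2: "hessian_matrix \<mu> \<alpha> =
      (1/2) *\<^sub>R (\<Sum>m\<in>UNIV. \<Sum>n\<in>UNIV. transpose (D\<phi> m) ** diag (ddW2 m n \<alpha>) ** D\<phi> n)"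
    unfolding hess ddW2
    by (simp add: vec_eq_iff transpose_diag_mult_nth sum_distrib_left mult_ac
        del: distrib_left_numeral)
  show "W differentiable (at \<alpha>) \<and>
     jacobian_matrix W \<alpha> = (\<Sum>m\<in>UNIV. diag (dW m \<alpha>) ** D\<phi> m) \<and>
     \<mu> differentiable (at \<alpha>) \<and>
     (\<forall>j. partial_deriv (axis j 1) \<mu> differentiable (at \<alpha>)) \<and>
     hessian_matrix \<mu> \<alpha> =
       (\<Sum>m\<in>UNIV. \<Sum>n\<in>UNIV. transpose (D\<phi> m) **
          (diag (\<lambda>i. dW m \<alpha> i * dW n \<alpha> i) + diag (\<lambda>i. W \<alpha> $ i * ddW m n \<alpha> i)) ** D\<phi> n) \<and>
     hessian_matrix \<mu> \<alpha> =
       (1/2) *\<^sub>R (\<Sum>m\<in>UNIV. \<Sum>n\<in>UNIV. transpose (D\<phi> m) ** diag (ddW2 m n \<alpha>) ** D\<phi> n)"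
    unfolding diag_add
    by (intro conjI allI W_diff jac differentiableI[OF \<mu>'] differentiableI[OF d\<mu>'] hess hess2)
qed

end
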